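(* There is an absolute constant $c>0$ such that for all sufficiently large $n$, every integer $p$ with $1\le p\le \log n$, and every increment sequence $h_1,\ldots,h_p$ of positive integers with $h_p=1$, the following holds. Let $\pi$ be a uniformly random permutation of $\{1,\ldots,n\}$, and run $p$-pass Shellsort with increments $h_1,\ldots,h_p$ on $\pi$. Then the expected total number of inversions (data movements) performed, summed over all $p$ passes, is at least $c\, p\, n^{1+1/p}$. In other words, the average number of inversions is $\Omega\left(p n^{1+1/p}\right)$.
   Context: $\log$ denotes the binary logarithm. $p$-pass Shellsort with increments $h_1,\ldots,h_p$ (positive integers, $h_p=1$) sorts a list $a_1,\ldots,a_n$ into increasing order in $p$ passes. In pass $k$ ($k=1,\ldots,p$), for each $r\in\{1,\ldots,h_k\}$ the sublist (the "$h_k$-chain") consisting of the entries at positions $j$ with $j\equiv r \pmod{h_k}$ is sorted by straight insertion sort, in place within those positions. For an element $i$ and pass $k$, let $m_{i,k}$ be the number of elements in the $h_k$-chain containing $i$ that lie to the left of $i$ and are larger than $i$ at the beginning of pass $k$. The number of inversions (data movements) performed in pass $k$ is $\sum_{i=1}^n m_{i,k}$, i.e. the number of inversions inside the chains at the start of pass $k$. The total number of inversions is $M=\sum_{i=1}^n\sum_{k=1}^p m_{i,k}$. The constant $c$ does not depend on $n$, $p$ or the increments. *)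

theory Defs
  imports "HOL-Probability.Probability" "HOL-Combinatorics.Permutations"
begin

text \<open>A list \<open>a\<^sub>1, \<dots>, a\<^sub>n\<close> is represented by a function \<open>a\<close> on the positions \<open>{1..n}\<close>.\<close>

definition chain :: "nat \<Rightarrow> nat \<Rightarrow> nat \<Rightarrow> nat set" where
  "chain n h j = {l \<in> {1..n}. l mod h = j mod h}"

text \<open>The library function \<open>sort\<close> is insertion sort. The sorted chain is written back to the
  positions of the chain, so position \<open>j\<close> receives the entry whose (0-based) index is the number
  of chain positions to the left of \<open>j\<close>.\<close>

definition h_sort :: "nat \<Rightarrow> nat \<Rightarrow> (nat \<Rightarrow> nat) \<Rightarrow> nat \<Rightarrow> nat" where
  "h_sort n h a j =
     (if j \<in> {1..n}
      then sort (map a (sorted_list_of_set (chain n h j))) ! card {l \<in> chain n h j. l < j}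
      else a j)"

primrec after_passes :: "nat \<Rightarrow> (nat \<Rightarrow> nat) \<Rightarrow> (nat \<Rightarrow> nat) \<Rightarrow> nat \<Rightarrow> nat \<Rightarrow> nat" where
  "after_passes n h a 0 = a"
| "after_passes n h a (Suc k) = h_sort n (h (Suc k)) (after_passes n h a k)"

definition position :: "nat \<Rightarrow> (nat \<Rightarrow> nat) \<Rightarrow> nat \<Rightarrow> nat" where
  "position n a i = inv_into {1..n} a i"

definition left_larger :: "nat \<Rightarrow> nat \<Rightarrow> (nat \<Rightarrow> nat) \<Rightarrow> nat \<Rightarrow> nat" where
  "left_larger n h a i =
     card {l \<in> chain n h (position n a i). l < position n a i \<and> a l > i}"

text \<open>The number \<open>m\<^sub>i\<^sub>,\<^sub>k\<close>, for \<open>k \<ge> 1\<close>; the list at the beginning of pass \<open>k\<close> is the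
  one obtained after the first \<open>k - 1\<close> passes.\<close>

definition pass_inversions :: "nat \<Rightarrow> (nat \<Rightarrow> nat) \<Rightarrow> (nat \<Rightarrow> nat) \<Rightarrow> nat \<Rightarrow> nat \<Rightarrow> nat" where
  "pass_inversions n h a i k = left_larger n (h k) (after_passes n h a (k - 1)) i"

definition total_inversions :: "nat \<Rightarrow> nat \<Rightarrow> (nat \<Rightarrow> nat) \<Rightarrow> (nat \<Rightarrow> nat) \<Rightarrow> nat" where
  "total_inversions n p h a = (\<Sum>i=1..n. \<Sum>k=1..p. pass_inversions n h a i k)"

definition expected_inversions :: "nat \<Rightarrow> nat \<Rightarrow> (nat \<Rightarrow> nat) \<Rightarrow> real" where
  "expected_inversions n p h =
     measure_pmf.expectation (pmf_of_set {\<pi>. \<pi> permutes {1..n}})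
       (\<lambda>\<pi>. real (total_inversions n p h \<pi>))"

end

theory Submission
  imports Defs
begin

text \<open>
  The matrix \<open>(m\<^sub>i\<^sub>,\<^sub>k)\<close> determines the input permutation: the final list is sorted, and a
  pass can be undone once its row \<open>m\<^sub>i\<^sub>,\<^sub>k\<close>, \<open>i = 1, \<dots>, n\<close>, is known, because this row is a
  Lehmer code of the chains. Hence \<open>\<Sum>\<^sub>\<pi> t\<^sup>M \<le> (1 - t)\<^sup>-\<^sup>n\<^sup>p\<close> for \<open>0 < t < 1\<close>, and Jensen's
  inequality gives \<open>E M \<cdot> ln (1 / t) \<ge> ln n! - n p ln (1 / (1 - t))\<close>. With \<open>x = n\<^bsup>1/p\<^esup> \<ge> 2\<close>, so
  that \<open>ln n! \<ge> n (p ln x - 1)\<close>, the choice \<open>t = x / (x + 8)\<close> yields the bound.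
\<close>

section \<open>Chains and ranks within a finite set\<close>

lemma finite_chain [simp]: "finite (chain n h j)"
  by (simp add: chain_def)

lemma self_in_chain: "j \<in> {1..n} \<Longrightarrow> j \<in> chain n h j"
  by (simp add: chain_def)

lemma card_below_less:
  fixes x y :: "'a::linorder"
  assumes "finite S" "x \<in> S" "x < y"
  shows "card {l \<in> S. l < x} < card {l \<in> S. l < y}"
  using assms by (intro psubset_card_mono) auto

lemma card_below_eq_iff:
  fixes x y :: "'a::linorder"
  assumes "finite S" "x \<in> S" "y \<in> S"
  shows "card {l \<in> S. l < x} = card {l \<in> S. l < y} \<longleftrightarrow> x = y"
  using card_below_less[OF assms(1,2), of y] card_below_less[OF assms(1,3), of x]
  by (cases x y rule: linorder_cases) auto

lemma card_below_less_card:
  fixes x :: "'a::linorder"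
  assumes "finite S" "x \<in> S"
  shows "card {l \<in> S. l < x} < card S"
  using assms by (intro psubset_card_mono) auto

section \<open>One pass as a map on permutations\<close>

lemma h_sort_in_chain:
  assumes "j \<in> {1..n}"
  obtains l where "l \<in> chain n h j" "h_sort n h a j = a l"
proof -
  let ?xs = "sort (map a (sorted_list_of_set (chain n h j)))"
  have "card {l \<in> chain n h j. l < j} < length ?xs"
    using card_below_less_card[OF finite_chain self_in_chain[OF assms]] by simp
  then have "h_sort n h a j \<in> set ?xs"
    unfolding h_sort_def if_P[OF assms] by (rule nth_mem)
  then show ?thesis using that by auto
qed

text \<open>Equal outputs stem from one input position, since \<open>a\<close> is injective. So both
  output positions lie in one chain, and distinctness of its sorted list forces equal ranks
  there.\<close>

lemma h_sort_permutes:
  assumes a: "a permutes {1..n}"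
  shows "h_sort n h a permutes {1..n}"
proof -
  have "inj_on (h_sort n h a) {1..n}"
  proof (rule inj_onI)
    fix i j assume i: "i \<in> {1..n}" and j: "j \<in> {1..n}" and eq: "h_sort n h a i = h_sort n h a j"
    obtain l where l: "l \<in> chain n h i" "h_sort n h a i = a l" using h_sort_in_chain[OF i] .
    obtain m where m: "m \<in> chain n h j" "h_sort n h a j = a m" using h_sort_in_chain[OF j] .
    have "l = m" using permutes_inj[OF a] eq l(2) m(2) by (auto dest: injD)
    then have ch: "chain n h i = chain n h j" using l m by (simp add: chain_def)
    let ?xs = "sort (map a (sorted_list_of_set (chain n h j)))"
    have "distinct ?xs"
      using permutes_inj[OF a] by (simp add: distinct_map inj_on_def inj_def)
    moreover have "?xs ! card {l \<in> chain n h j. l < i} = ?xs ! card {l \<in> chain n h j. l < j}"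
      using eq i j ch by (simp add: h_sort_def)
    moreover have "i \<in> chain n h j" "j \<in> chain n h j"
      using self_in_chain[OF i] self_in_chain[OF j] ch by auto
    ultimately show "i = j"
      by (simp add: nth_eq_iff_index_eq card_below_less_card card_below_eq_iff)
  qed
  moreover have "h_sort n h a ` {1..n} \<subseteq> {1..n}"
  proof
    fix y assume "y \<in> h_sort n h a ` {1..n}"
    then obtain j where j: "j \<in> {1..n}" "y = h_sort n h a j" by blast
    obtain l where l: "l \<in> chain n h j" "h_sort n h a j = a l" using h_sort_in_chain[OF j(1)] .
    then have "l \<in> {1..n}" by (simp add: chain_def)
    then show "y \<in> {1..n}" using permutes_in_image[OF a] j l by metis
  qed
  ultimately have "bij_betw (h_sort n h a) {1..n} {1..n}"
    by (simp add: bij_betw_def endo_inj_surj)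
  moreover have "h_sort n h a j = j" if "j \<notin> {1..n}" for j
    unfolding h_sort_def if_not_P[OF that] using a that by (rule permutes_not_in)
  ultimately show ?thesis by (rule bij_imp_permutes)
qed

text \<open>With increment 1 there is a single chain, so the last pass erases all information about
  the input. This gives the reconstruction a common starting point.\<close>

lemma h_sort_one:
  assumes a: "a permutes {1..n}"
  shows "h_sort n 1 a = id"
proof
  fix j
  show "h_sort n 1 a j = id j"
  proof (cases "j \<in> {1..n}")
    case True
    have ch: "chain n 1 j = {1..n}" by (auto simp: chain_def)
    let ?xs = "map a (sorted_list_of_set {1..n})"
    have "distinct ?xs"
      using permutes_inj[OF a] by (simp add: distinct_map inj_on_def inj_def)
    then have "sort ?xs = sorted_list_of_set (set ?xs)"
      by (metis sorted_list_of_set_sort_remdups distinct_remdups_id)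
    also have "set ?xs = {1..n}" using permutes_image[OF a] by simp
    also have "sorted_list_of_set {1..n} = [1..<Suc n]"
      by (metis atLeastLessThanSuc_atLeastAtMost sorted_list_of_set_range)
    finally have "sort ?xs = [1..<Suc n]" .
    moreover have "{l \<in> {1..n}. l < j} = {1..<j}" using True by auto
    ultimately show ?thesis
      unfolding h_sort_def if_P[OF True] ch using True by (simp del: upt_Suc)
  next
    case False
    then show ?thesis using permutes_not_in[OF a] by (auto simp: h_sort_def)
  qed
qed

section \<open>Undoing one pass from its Lehmer code\<close>

lemma position_permutes:
  assumes "a permutes {1..n}" "i \<in> {1..n}"
  shows "position n a i \<in> {1..n}" "a (position n a i) = i"
  using assms permutes_image[of a "{1..n}"] unfolding position_def
  by (metis inv_into_into, metis f_inv_into_f)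

lemma position_eqI:
  assumes "a permutes {1..n}" "l \<in> {1..n}" "a l = i"
  shows "position n a i = l"
  using assms permutes_inj_on[of a "{1..n}"] unfolding position_def by (metis inv_into_f_f)

text \<open>Entries never leave their chain, so the list after a pass still reveals which chain each
  element occupied before it.\<close>

lemma position_h_sort_mod:
  assumes a: "a permutes {1..n}" and i: "i \<in> {1..n}"
  shows "position n a i mod h = position n (h_sort n h a) i mod h"
proof -
  let ?j = "position n (h_sort n h a) i"
  have j: "?j \<in> {1..n}" "h_sort n h a ?j = i"
    using position_permutes[OF h_sort_permutes[OF a] i] by auto
  obtain l where l: "l \<in> chain n h ?j" "h_sort n h a ?j = a l" using h_sort_in_chain[OF j(1)] .
  have "position n a i = l" using a l j by (intro position_eqI) (auto simp: chain_def)
  then show ?thesis using l by (simp add: chain_def)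
qed

text \<open>The elements are placed in increasing order of value: the sorted list gives the chain of
  \<open>i\<close>, and the code gives its rank among the chain positions not taken by smaller
  elements.\<close>

lemma h_sort_left_larger_inject:
  assumes a: "a permutes {1..n}" and b: "b permutes {1..n}"
    and sorted: "h_sort n h a = h_sort n h b"
    and code: "\<And>i. i \<in> {1..n} \<Longrightarrow> left_larger n h a i = left_larger n h b i"
  shows "a = b"
proof -
  have pos: "position n a i = position n b i" if "i \<in> {1..n}" for i
    using that
  proof (induction i rule: less_induct)
    case (less i)
    define C where "C = chain n h (position n a i)"
    have C_b: "C = chain n h (position n b i)"
      using position_h_sort_mod[OF a less.prems, of h] position_h_sort_mod[OF b less.prems, of h]
        sorted by (simp add: C_def chain_def)
    have C_sub: "C \<subseteq> {1..n}" by (auto simp: C_def chain_def)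
    \<comment> \<open>Once the positions of the smaller entries are known, the code counts the remaining
      positions to the left of the entry \<open>i\<close>.\<close>
    define S where "S = {l \<in> C. \<not> a l < i}"
    \<comment> \<open>By the induction hypothesis each smaller element has the same position in
      \<open>a\<close> and \<open>b\<close>, so \<open>S\<close> is the same set for both.\<close>
    have less_iff: "a l < i \<longleftrightarrow> b l < i" if "l \<in> {1..n}" for l
    proof
      assume lt: "a l < i"
      have "a l \<in> {1..n}" using permutes_in_image[OF a] that by blast
      then have "position n b (a l) = l"
        using less.IH[OF lt] position_eqI[OF a that] by simp
      then show "b l < i" using position_permutes(2)[OF b \<open>a l \<in> {1..n}\<close>] lt by simp
    next
      assume lt: "b l < i"
      have "b l \<in> {1..n}" using permutes_in_image[OF b] that by blast
      then have "position n a (b l) = l"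
        using less.IH[OF lt] position_eqI[OF b that] by simp
      then show "a l < i" using position_permutes(2)[OF a \<open>b l \<in> {1..n}\<close>] lt by simp
    qed
    have S_b: "S = {l \<in> C. \<not> b l < i}" using less_iff C_sub by (auto simp: S_def)
    have fin: "finite S" by (simp add: S_def C_def)
    note pa = position_permutes[OF a less.prems] and pb = position_permutes[OF b less.prems]
    have mem: "position n a i \<in> S" "position n b i \<in> S"
      using self_in_chain[OF pa(1), of h] pa(2) self_in_chain[OF pb(1), of h] pb(2)
      by (simp add: S_def C_def, simp add: S_b C_b)
    \<comment> \<open>To the left of \<open>i\<close>, not smaller means larger, so the code of
      \<open>i\<close> is the rank of its position in \<open>S\<close>.\<close>
    have "a l \<noteq> i" if "l \<in> C" "l < position n a i" for l
      using position_eqI[OF a, of l i] C_sub that by auto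
    then have "{l \<in> C. l < position n a i \<and> a l > i} = {l \<in> S. l < position n a i}"
      unfolding S_def by (auto simp: not_less order.order_iff_strict)
    moreover have "b l \<noteq> i" if "l \<in> C" "l < position n b i" for l
      using position_eqI[OF b, of l i] C_sub that by auto
    then have "{l \<in> C. l < position n b i \<and> b l > i} = {l \<in> S. l < position n b i}"
      unfolding S_b by (auto simp: not_less order.order_iff_strict)
    ultimately have "card {l \<in> S. l < position n a i} = card {l \<in> S. l < position n b i}"
      using code[OF less.prems] unfolding left_larger_def C_b[symmetric] C_def[symmetric] by simp
    then show ?case using card_below_eq_iff[OF fin mem] by simp
  qed
  show "a = b"
  proof
    fix l
    show "a l = b l"
    proof (cases "l \<in> {1..n}")
      case True
      then have al: "a l \<in> {1..n}" using permutes_in_image[OF a] by blast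
      have "position n b (a l) = l" using pos[OF al] position_eqI[OF a True] by simp
      then show ?thesis using position_permutes(2)[OF b al] by simp
    next
      case False
      then show ?thesis using permutes_not_in[OF a] permutes_not_in[OF b] by metis
    qed
  qed
qed

section \<open>Recovering the input from all passes\<close>

lemma after_passes_permutes:
  "a permutes {1..n} \<Longrightarrow> after_passes n h a k permutes {1..n}"
  by (induction k) (simp, simp only: after_passes.simps h_sort_permutes)

text \<open>The passes are undone one at a time, from the last to the first.\<close>

lemma after_passes_inject:
  assumes a: "a permutes {1..n}" and b: "b permutes {1..n}"
    and "after_passes n h a k = after_passes n h b k"
    and "\<And>i j. i \<in> {1..n} \<Longrightarrow> j \<in> {1..k} \<Longrightarrow> pass_inversions n h a i j = pass_inversions n h b i j"
  shows "a = b"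
  using assms(3,4)
proof (induction k)
  case 0
  then show ?case by simp
next
  case (Suc k)
  have "after_passes n h a k = after_passes n h b k"
  proof (rule h_sort_left_larger_inject[OF after_passes_permutes[OF a] after_passes_permutes[OF b]])
    show "h_sort n (h (Suc k)) (after_passes n h a k) = h_sort n (h (Suc k)) (after_passes n h b k)"
      using Suc.prems(1) by simp
    show "left_larger n (h (Suc k)) (after_passes n h a k) i =
          left_larger n (h (Suc k)) (after_passes n h b k) i" if "i \<in> {1..n}" for i
      using Suc.prems(2)[OF that, of "Suc k"] by (simp add: pass_inversions_def)
  qed
  then show ?case using Suc.prems(2) by (intro Suc.IH) auto
qed

lemma pass_inversions_inject:
  assumes a: "a permutes {1..n}" and b: "b permutes {1..n}" and p: "p \<ge> 1" "h p = 1"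
    and "\<And>i k. i \<in> {1..n} \<Longrightarrow> k \<in> {1..p} \<Longrightarrow> pass_inversions n h a i k = pass_inversions n h b i k"
  shows "a = b"
proof (rule after_passes_inject[OF a b _ assms(5)])
  obtain q where q: "p = Suc q" using p(1) by (cases p) auto
  then show "after_passes n h a p = after_passes n h b p"
    using p(2) h_sort_one after_passes_permutes[OF a] after_passes_permutes[OF b] by simp
qed

section \<open>The generating function of the inversion count\<close>

lemma pass_inversions_le: "pass_inversions n h a i k \<le> n"
proof -
  have "pass_inversions n h a i k \<le> card {1..n}"
    unfolding pass_inversions_def left_larger_def by (rule card_mono) (auto simp: chain_def)
  then show ?thesis by simp
qed

text \<open>Permutations correspond injectively to matrices with \<open>n * p\<close> entries in
  \<open>{..n}\<close>. Summing over all such matrices factorises into one truncated geometric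
  series per entry.\<close>

lemma sum_power_total_inversions_le:
  fixes t :: real
  assumes p: "p \<ge> 1" "h p = 1" and t: "0 < t" "t < 1"
  shows "(\<Sum>\<pi> | \<pi> permutes {1..n}. t ^ total_inversions n p h \<pi>) \<le> (1 / (1 - t)) ^ (n * p)"
proof -
  let ?I = "{1..n} \<times> {1..p}" and ?P = "{\<pi>. \<pi> permutes {1..n}}"
  \<comment> \<open>Restriction makes the matrix \<open>undefined\<close> outside \<open>?I\<close>,
    as membership in \<open>PiE\<close> requires.\<close>
  define m where "m \<pi> = restrict (\<lambda>(i, k). pass_inversions n h \<pi> i k) ?I" for \<pi>
  have m_apply: "m \<pi> (i, k) = pass_inversions n h \<pi> i k" if "i \<in> {1..n}" "k \<in> {1..p}" for \<pi> i k
    using that by (simp add: m_def)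
  have "inj_on m ?P"
  proof (rule inj_onI)
    fix a b assume "a \<in> ?P" "b \<in> ?P" and eq: "m a = m b"
    then show "a = b"
      using m_apply by (intro pass_inversions_inject[where h = h and p = p] p) (auto, metis)
  qed
  have total: "total_inversions n p h \<pi> = (\<Sum>z\<in>?I. m \<pi> z)" for \<pi>
    unfolding total_inversions_def sum.cartesian_product by (rule sum.cong) (auto simp: m_def)
  have "(\<Sum>\<pi>\<in>?P. t ^ total_inversions n p h \<pi>) = (\<Sum>\<pi>\<in>?P. \<Prod>z\<in>?I. t ^ m \<pi> z)"
    by (simp only: total power_sum)
  also have "\<dots> = (\<Sum>g\<in>m ` ?P. \<Prod>z\<in>?I. t ^ g z)"
    using \<open>inj_on m ?P\<close> by (simp add: sum.reindex)
  also have "\<dots> \<le> (\<Sum>g\<in>PiE ?I (\<lambda>_. {..n}). \<Prod>z\<in>?I. t ^ g z)"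
  proof (rule sum_mono2)
    show "finite (PiE ?I (\<lambda>_. {..n}))" by (intro finite_PiE) auto
    show "m ` ?P \<subseteq> PiE ?I (\<lambda>_. {..n})"
      unfolding m_def image_subset_iff restrict_PiE_iff by (auto simp: pass_inversions_le)
    show "\<And>g. 0 \<le> (\<Prod>z\<in>?I. t ^ g z)" using t by (intro prod_nonneg) auto
  qed
  also have "\<dots> = (\<Prod>z\<in>?I. \<Sum>j\<le>n. t ^ j)"
    by (rule prod_sum_PiE[symmetric]) auto
  also have "\<dots> = (\<Sum>j\<le>n. t ^ j) ^ (n * p)" by simp
  also have "\<dots> \<le> (1 / (1 - t)) ^ (n * p)"
  proof (rule power_mono)
    have "(\<Sum>j\<le>n. t ^ j) \<le> (\<Sum>j. t ^ j)"
      using t by (intro sum_le_suminf summable_geometric) auto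
    then show "(\<Sum>j\<le>n. t ^ j) \<le> 1 / (1 - t)" using t by (simp add: suminf_geometric)
    show "0 \<le> (\<Sum>j\<le>n. t ^ j)" using t by (intro sum_nonneg) auto
  qed
  finally show ?thesis .
qed

section \<open>From the generating function to the expectation\<close>

lemma permutations_nonempty: "{\<pi>. \<pi> permutes S} \<noteq> {}"
  using permutes_id by blast

lemma expected_inversions_eq:
  "expected_inversions n p h =
     (\<Sum>\<pi> | \<pi> permutes {1..n}. real (total_inversions n p h \<pi>)) / fact n"
  unfolding expected_inversions_def
  by (subst integral_pmf_of_set[OF permutations_nonempty])
     (auto simp: finite_permutations card_permutations)

lemma Jensen_exp_sum:
  fixes f :: "'a \<Rightarrow> real"
  assumes "finite A" "A \<noteq> {}"
  shows "real (card A) * exp ((\<Sum>x\<in>A. f x) / real (card A)) \<le> (\<Sum>x\<in>A. exp (f x))"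
proof -
  define \<mu> where "\<mu> = (\<Sum>x\<in>A. f x) / real (card A)"
  have "card A > 0" using assms by (simp add: card_gt_0_iff)
  then have sum_f: "(\<Sum>x\<in>A. f x) = real (card A) * \<mu>" by (simp add: \<mu>_def)
  \<comment> \<open>The deviations from the mean sum to 0; the right side is the tangent of
    \<open>exp\<close> at \<open>\<mu>\<close>, which lies below \<open>exp\<close>.\<close>
  have "real (card A) * exp \<mu> = (\<Sum>x\<in>A. exp \<mu> * (1 + (f x - \<mu>)))"
    by (simp add: sum_distrib_left[symmetric] sum.distrib sum_subtractf sum_f)
  also have "\<dots> \<le> (\<Sum>x\<in>A. exp \<mu> * exp (f x - \<mu>))"
    by (intro sum_mono mult_left_mono exp_ge_add_one_self) auto
  also have "\<dots> = (\<Sum>x\<in>A. exp (f x))" by (simp add: exp_add[symmetric])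
  finally show ?thesis by (simp add: \<mu>_def)
qed

lemma expected_inversions_ge:
  fixes t :: real
  assumes p: "p \<ge> 1" "h p = 1" and t: "0 < t" "t < 1"
  shows "expected_inversions n p h * ln (1 / t) \<ge> ln (fact n) - real (n * p) * ln (1 / (1 - t))"
proof -
  let ?P = "{\<pi>. \<pi> permutes {1..n}}" and ?M = "total_inversions n p h"
  have P: "finite ?P" "card ?P = fact n"
    by (auto simp: finite_permutations card_permutations)
  have "fact n * exp (expected_inversions n p h * ln t) \<le> (\<Sum>\<pi>\<in>?P. exp (real (?M \<pi>) * ln t))"
    using Jensen_exp_sum[OF P(1) permutations_nonempty, of "\<lambda>\<pi>. real (?M \<pi>) * ln t"] P(2)
    by (simp add: expected_inversions_eq sum_distrib_right)
  also have "\<dots> = (\<Sum>\<pi>\<in>?P. t ^ ?M \<pi>)"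
    using t by (simp add: exp_of_nat_mult)
  also have "\<dots> \<le> (1 / (1 - t)) ^ (n * p)"
    by (rule sum_power_total_inversions_le[where h = h, OF p t])
  finally have le: "fact n * exp (expected_inversions n p h * ln t) \<le> (1 / (1 - t)) ^ (n * p)" .
  have "ln (fact n * exp (expected_inversions n p h * ln t)) \<le> ln ((1 / (1 - t)) ^ (n * p))"
    using le t by (subst ln_le_cancel_iff) (auto intro!: zero_less_power)
  then have "ln (fact n) + expected_inversions n p h * ln t \<le> real (n * p) * ln (1 / (1 - t))"
    using t by (simp add: ln_mult ln_realpow)
  then show ?thesis using t by (simp add: ln_div)
qed

section \<open>Choice of the parameter and the final estimate\<close>

lemma ln_fact_ge:
  assumes "n > 0"
  shows "ln (fact n) \<ge> real n * (ln (real n) - 1)"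
proof -
  have "real n ^ n / fact n \<le> exp (real n)"
  proof -
    \<comment> \<open>A single term of the exponential series at \<open>n\<close> already
      suffices.\<close>
    have "(\<Sum>k\<in>{n}. real n ^ k /\<^sub>R fact k) \<le> (\<Sum>k. real n ^ k /\<^sub>R fact k)"
      by (intro sum_le_suminf summable_exp_generic) auto
    then show ?thesis by (simp add: exp_def field_simps)
  qed
  then have "ln (real n ^ n / fact n) \<le> ln (exp (real n))"
    using assms by (subst ln_le_cancel_iff) auto
  then show ?thesis using assms by (simp add: ln_div ln_realpow algebra_simps)
qed

lemma expected_inversions_lower_bound:
  assumes n: "n \<ge> 2 ^ 30" and p: "1 \<le> p" "real p \<le> log 2 (real n)" and hp: "h p = 1"
  shows "expected_inversions n p h \<ge> 1 / 32 * real p * real n powr (1 + 1 / real p)"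
proof -
  define x where "x = real n powr (1 / real p)"
  define E where "E = expected_inversions n p h"
  have n0: "real n > 0" using n by (cases n) auto
  have x0: "x > 0" using n0 by (simp add: x_def)
  have ln_x: "real p * ln x = ln (real n)" using p n0 by (simp add: x_def ln_powr)
  have ln_n: "ln (real n) \<ge> 30 * ln 2"
  proof -
    have "2 ^ 30 \<le> real n" using n by (metis of_nat_le_iff of_nat_numeral of_nat_power)
    then have "ln (2 ^ 30) \<le> ln (real n)" by (subst ln_le_cancel_iff) (use n0 in auto)
    then show ?thesis by (simp only: ln_realpow)
  qed
  have "real p * ln 2 \<le> real p * ln x" using p(2) ln_x by (simp add: log_def field_simps)
  then have "x \<ge> 2" using p(1) x0 by simp
  \<comment> \<open>For \<open>t = x / (x + 8)\<close> this is the gain per unit of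
    \<open>n * p\<close>: \<open>ln x\<close> comes from the factorial,
    \<open>ln ((x + 8) / 8)\<close> is the cost of the matrices, and \<open>1 / p\<close> is the
    error in \<open>ln_fact_ge\<close>.\<close>
  have "ln (8 * x / (x + 8)) - 1 / real p \<ge> 1 / 4"
  proof (cases "x \<ge> 8")
    \<comment> \<open>Here \<open>8 * x / (x + 8) \<ge> 4\<close>, and \<open>4 / 3 - 1\<close>
      exceeds \<open>1 / 4\<close> even when \<open>p = 1\<close>.\<close>
    case True
    have "4 / 3 \<le> 2 * ln (2 :: real)" using ln2_ge_two_thirds by simp
    also have "\<dots> = ln (2 ^ 2 :: real)" by (simp only: ln_realpow)
    also have "\<dots> \<le> ln (8 * x / (x + 8))"
      using True by (subst ln_le_cancel_iff) (auto simp: field_simps)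
    moreover have "1 / real p \<le> 1" using p(1) by simp
    ultimately show ?thesis by simp
  next
    \<comment> \<open>A small \<open>x\<close> forces a large \<open>p\<close>:
      \<open>n \<ge> 2 ^ 30\<close> and \<open>x < 8\<close> give \<open>p \<ge> 10\<close>. The
      logarithm is at least \<open>3 / 8\<close>, the worst case of the linear bound being
      \<open>x = 2\<close>, and \<open>3 / 8 - 1 / 10 > 1 / 4\<close>.\<close>
    case False
    have "ln x \<le> ln (2 ^ 3)" using False x0 by (subst ln_le_cancel_iff) auto
    then have "ln x \<le> 3 * ln 2" by (simp only: ln_realpow)
    then have "real p * ln x \<le> real p * (3 * ln 2)" by (rule mult_left_mono) simp
    then have "10 * (3 * ln 2) \<le> real p * (3 * ln (2 :: real))" using ln_x ln_n by linarith
    then have "real p \<ge> 10" by simp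
    then have "1 / real p \<le> 1 / 10" by (simp add: field_simps)
    moreover have "ln ((x + 8) / (8 * x)) \<le> (x + 8) / (8 * x) - 1"
      using x0 by (intro ln_le_minus_one) auto
    moreover have "(x + 8) / (8 * x) \<le> 5 / 8" using \<open>x \<ge> 2\<close> by (simp add: field_simps)
    moreover have "ln (8 * x / (x + 8)) = - ln ((x + 8) / (8 * x))"
      using x0 by (simp add: ln_div)
    ultimately show ?thesis by linarith
  qed
  then have "real p * (1 / 4) \<le> real p * (ln (8 * x / (x + 8)) - 1 / real p)"
    by (rule mult_left_mono) simp
  also have "\<dots> = real p * ln x - 1 - real p * ln ((x + 8) / 8)"
    using p(1) x0 by (simp add: ln_div ln_mult algebra_simps)
  finally have "real n * (real p * (1 / 4)) \<le> real n * (ln (real n) - 1 - real p * ln ((x + 8) / 8))"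
    unfolding ln_x by (rule mult_left_mono) simp
  also have "\<dots> \<le> ln (fact n) - real (n * p) * ln ((x + 8) / 8)"
    using ln_fact_ge[of n] n0 by (simp add: algebra_simps)
  also have "\<dots> \<le> E * ln ((x + 8) / x)"
  proof -
    have t: "0 < x / (x + 8)" "x / (x + 8) < 1" using x0 by auto
    have eq: "1 / (1 - x / (x + 8)) = (x + 8) / 8" using x0 by (simp add: field_simps)
    show ?thesis
      using expected_inversions_ge[where n = n and h = h, OF p(1) hp t] unfolding eq E_def by simp
  qed
  \<comment> \<open>Since \<open>ln (1 / t) \<le> 8 / x\<close>, dividing the gain
    \<open>1 / 4\<close> by 8 produces the constant \<open>1 / 32\<close>, and \<open>n * x\<close>
    is the required power of \<open>n\<close>.\<close>
  also have "\<dots> \<le> E * (8 / x)"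
  proof (rule mult_left_mono)
    have "ln ((x + 8) / x) \<le> (x + 8) / x - 1" using x0 by (intro ln_le_minus_one) auto
    then show "ln ((x + 8) / x) \<le> 8 / x" using x0 by (simp add: field_simps)
    show "E \<ge> 0" unfolding E_def expected_inversions_eq by (intro divide_nonneg_nonneg sum_nonneg) auto
  qed
  finally have "E \<ge> 1 / 32 * real p * (real n * x)" using x0 by (simp add: field_simps)
  then show ?thesis using n0 by (simp add: E_def x_def powr_add)
qed

theorem theorem1:
  "\<exists>c::real. c > 0 \<and>
     (\<exists>N::nat. \<forall>n\<ge>N. \<forall>p::nat. 1 \<le> p \<and> real p \<le> log 2 (real n) \<longrightarrow>
        (\<forall>h::nat \<Rightarrow> nat. (\<forall>k\<in>{1..p}. h k > 0) \<and> h p = 1 \<longrightarrow>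
           expected_inversions n p h \<ge> c * real p * real n powr (1 + 1 / real p)))"
  using expected_inversions_lower_bound
  by (intro exI[of _ "1 / 32"] conjI exI[of _ "2 ^ 30"]) auto

end
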